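(* The operator $S_{L(H^2)}:L(H^2)\to L(H^2)$, $S_{L(H^2)}(T)=ST$, is an isometry.
   Context: $\mathbf{D}$ is the open unit disc in $\mathbb{C}$. $H^2$ is the Hardy space of analytic functions $f(z)=\sum_{n\ge 0}a_nz^n$ on $\mathbf{D}$ with $\sum_{n\ge 0}|a_n|^2<\infty$, a Hilbert space with inner product $(f,g)=\sum_n a_n\overline{b_n}$ for $f(z)=\sum a_nz^n$, $g(z)=\sum b_nz^n$. $L(H^2)$ is the Banach space of bounded linear operators on $H^2$ with the operator norm. $S\in L(H^2)$ is the shift $(Sf)(z)=zf(z)$. *)

theory Defs
  imports "HOL-Complex_Analysis.Complex_Analysis"
begin

text \<open>
  The function \<open>f\<close> is total on the complex plane; setting it to 0 outside the open unit disc makes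
  equality in the type below the equality of functions on the disc. The numbers
  \<open>fps_nth (fps_expansion f 0) n\<close> are the Taylor coefficients of \<open>f\<close> at 0.
\<close>

definition hardy_set :: "(complex \<Rightarrow> complex) set" where
  "hardy_set = {f. f holomorphic_on ball 0 1 \<and> (\<forall>z. z \<notin> ball 0 1 \<longrightarrow> f z = 0) \<and>
                   summable (\<lambda>n. (cmod (fps_nth (fps_expansion f 0) n))\<^sup>2)}"

lemma holomorphic_has_fps_expansion:
  assumes "f holomorphic_on ball 0 1"
  shows "f has_fps_expansion fps_expansion f 0"
proof -
  have "f analytic_on {0}"
    using assms by (meson analytic_at centre_in_ball open_ball zero_less_one)
  then show ?thesis
    by (rule analytic_at_imp_has_fps_expansion_0)
qed

lemma fps_expansion_add_disc:
  assumes "f holomorphic_on ball 0 1" "g holomorphic_on ball 0 1"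
  shows "fps_expansion (\<lambda>z. f z + g z) 0 = fps_expansion f 0 + fps_expansion g 0"
  by (intro fps_expansion_eqI has_fps_expansion_add holomorphic_has_fps_expansion assms)

lemma fps_expansion_cmult_disc:
  assumes "f holomorphic_on ball 0 1"
  shows "fps_expansion (\<lambda>z. c * f z) 0 = fps_const c * fps_expansion f 0"
  by (intro fps_expansion_eqI has_fps_expansion_cmult_left holomorphic_has_fps_expansion assms)

lemma fps_expansion_shift_disc:
  assumes "f holomorphic_on ball 0 1"
  shows "fps_expansion (\<lambda>z. z * f z) 0 = fps_X * fps_expansion f 0"
  by (intro fps_expansion_eqI has_fps_expansion_mult has_fps_expansion_fps_X
      holomorphic_has_fps_expansion assms)

lemma summable_norm_sq_add:
  fixes a b :: "nat \<Rightarrow> complex"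
  assumes "summable (\<lambda>n. (cmod (a n))\<^sup>2)" "summable (\<lambda>n. (cmod (b n))\<^sup>2)"
  shows "summable (\<lambda>n. (cmod (a n + b n))\<^sup>2)"
proof (rule summable_comparison_test')
  show "summable (\<lambda>n. 2 * (cmod (a n))\<^sup>2 + 2 * (cmod (b n))\<^sup>2)"
    using assms by (intro summable_add summable_mult)
  fix n
  have "(cmod (a n + b n))\<^sup>2 \<le> (cmod (a n) + cmod (b n))\<^sup>2"
    by (intro power_mono norm_triangle_ineq norm_ge_zero)
  also have "\<dots> \<le> 2 * (cmod (a n))\<^sup>2 + 2 * (cmod (b n))\<^sup>2"
    using sum_squares_bound[of "cmod (a n)" "cmod (b n)"] by (simp add: power2_sum)
  finally show "norm ((cmod (a n + b n))\<^sup>2) \<le> 2 * (cmod (a n))\<^sup>2 + 2 * (cmod (b n))\<^sup>2"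
    by simp
qed

lemma summable_mult_cnj:
  fixes a b :: "nat \<Rightarrow> complex"
  assumes "summable (\<lambda>n. (cmod (a n))\<^sup>2)" "summable (\<lambda>n. (cmod (b n))\<^sup>2)"
  shows "summable (\<lambda>n. a n * cnj (b n))"
proof (rule summable_comparison_test')
  show "summable (\<lambda>n. (cmod (a n))\<^sup>2 + (cmod (b n))\<^sup>2)"
    using assms by (intro summable_add)
  fix n
  have "2 * (cmod (a n) * cmod (b n)) \<le> (cmod (a n))\<^sup>2 + (cmod (b n))\<^sup>2"
    using sum_squares_bound[of "cmod (a n)" "cmod (b n)"] by simp
  moreover have "0 \<le> cmod (a n) * cmod (b n)"
    by simp
  ultimately show "norm (a n * cnj (b n)) \<le> (cmod (a n))\<^sup>2 + (cmod (b n))\<^sup>2"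
    unfolding norm_mult complex_mod_cnj by linarith
qed

lemma hardy_set_add:
  assumes "f \<in> hardy_set" "g \<in> hardy_set"
  shows "(\<lambda>z. f z + g z) \<in> hardy_set"
  using assms
  by (auto simp: hardy_set_def fps_expansion_add_disc intro!: holomorphic_intros summable_norm_sq_add)

lemma hardy_set_cmult:
  assumes "f \<in> hardy_set"
  shows "(\<lambda>z. c * f z) \<in> hardy_set"
  using assms
  by (auto simp: hardy_set_def fps_expansion_cmult_disc norm_mult power_mult_distrib
      intro!: holomorphic_intros)

lemma hardy_set_zero: "(\<lambda>z. 0) \<in> hardy_set"
proof -
  have "fps_expansion (\<lambda>z. 0) 0 = 0"
    by (intro fps_expansion_eqI has_fps_expansion_0)
  then show ?thesis
    by (simp add: hardy_set_def)
qed

lemma hardy_set_shift: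
  assumes "f \<in> hardy_set"
  shows "(\<lambda>z. z * f z) \<in> hardy_set"
proof -
  have "summable (\<lambda>n. (cmod (fps_nth (fps_X * fps_expansion f 0) n))\<^sup>2)"
    using assms by (subst summable_Suc_iff[symmetric]) (simp add: hardy_set_def)
  with assms show ?thesis
    by (auto simp: hardy_set_def fps_expansion_shift_disc intro!: holomorphic_intros)
qed

typedef hardy = hardy_set
  morphisms hardy_apply Abs_hardy
  using hardy_set_zero by blast

setup_lifting type_definition_hardy

lift_definition hardy_coeff :: "hardy \<Rightarrow> nat \<Rightarrow> complex"
  is "\<lambda>f n. fps_nth (fps_expansion f 0) n" .

lift_definition hardy_scaleC :: "complex \<Rightarrow> hardy \<Rightarrow> hardy"
  is "\<lambda>c f z. c * f z"
  by (rule hardy_set_cmult)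

definition hardy_cinner :: "hardy \<Rightarrow> hardy \<Rightarrow> complex" where
  "hardy_cinner f g = (\<Sum>n. hardy_coeff f n * cnj (hardy_coeff g n))"

lemma summable_hardy_coeff: "summable (\<lambda>n. (cmod (hardy_coeff f n))\<^sup>2)"
  by transfer (simp add: hardy_set_def)

lemma summable_hardy_cinner: "summable (\<lambda>n. hardy_coeff f n * cnj (hardy_coeff g n))"
  by (intro summable_mult_cnj summable_hardy_coeff)

lemma hardy_coeff_sums:
  assumes "z \<in> ball 0 1"
  shows "(\<lambda>n. hardy_coeff f n * z ^ n) sums hardy_apply f z"
  using assms
proof (transfer fixing: z)
  fix f assume "f \<in> hardy_set"
  then have "f holomorphic_on ball 0 1" by (simp add: hardy_set_def)
  from holomorphic_power_series[OF this assms]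
  show "(\<lambda>n. fps_nth (fps_expansion f 0) n * z ^ n) sums f z"
    by (simp add: fps_expansion_def)
qed

lemma hardy_eqI:
  assumes "\<And>n. hardy_coeff f n = hardy_coeff g n"
  shows "f = g"
proof -
  have "hardy_apply f z = hardy_apply g z" for z
  proof (cases "z \<in> ball 0 1")
    case True
    then show ?thesis
      using hardy_coeff_sums[OF True, of f] hardy_coeff_sums[OF True, of g] assms
      by (auto dest: sums_unique2)
  next
    case False
    then show ?thesis
      using hardy_apply[of f] hardy_apply[of g] by (auto simp: hardy_set_def)
  qed
  then show ?thesis
    by (metis hardy_apply_inject ext)
qed

instantiation hardy :: real_vector
begin

lift_definition zero_hardy :: hardy is "\<lambda>z. 0" by (rule hardy_set_zero)

lift_definition plus_hardy :: "hardy \<Rightarrow> hardy \<Rightarrow> hardy" is "\<lambda>f g z. f z + g z"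
  by (rule hardy_set_add)

lift_definition uminus_hardy :: "hardy \<Rightarrow> hardy" is "\<lambda>f z. - f z"
  using hardy_set_cmult[where c = "-1"] by simp

definition minus_hardy :: "hardy \<Rightarrow> hardy \<Rightarrow> hardy" where
  "minus_hardy f g = f + (- g)"

definition scaleR_hardy :: "real \<Rightarrow> hardy \<Rightarrow> hardy" where
  "scaleR_hardy r f = hardy_scaleC (complex_of_real r) f"

instance
proof
  fix f g h :: hardy and r s :: real
  show "f + g + h = f + (g + h)" "f + g = g + f" "0 + f = f" "- f + f = 0"
    by (transfer; simp add: algebra_simps)+
  show "f - g = f + - g" by (rule minus_hardy_def)
  show "r *\<^sub>R (f + g) = r *\<^sub>R f + r *\<^sub>R g" "(r + s) *\<^sub>R f = r *\<^sub>R f + s *\<^sub>R f"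
    "r *\<^sub>R s *\<^sub>R f = (r * s) *\<^sub>R f" "1 *\<^sub>R f = f"
    unfolding scaleR_hardy_def by (transfer; simp add: algebra_simps)+
qed

end

text \<open>
  The library's inner product spaces are real. The real inner product on \<open>H\<^sup>2\<close> is the real part of
  \<^const>\<open>hardy_cinner\<close>; it induces the same norm (see \<open>norm_hardy_eq\<close> below).
\<close>

instantiation hardy :: real_inner
begin

definition inner_hardy :: "hardy \<Rightarrow> hardy \<Rightarrow> real" where
  "inner_hardy f g = Re (hardy_cinner f g)"

definition norm_hardy :: "hardy \<Rightarrow> real" where
  "norm_hardy f = sqrt (inner f f)"

definition sgn_hardy :: "hardy \<Rightarrow> hardy" where
  "sgn_hardy f = f /\<^sub>R norm f"

definition dist_hardy :: "hardy \<Rightarrow> hardy \<Rightarrow> real" where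
  "dist_hardy f g = norm (f - g)"

definition uniformity_hardy :: "(hardy \<times> hardy) filter" where
  "uniformity_hardy = (INF e\<in>{0<..}. principal {(x, y). dist x y < e})"

definition open_hardy :: "hardy set \<Rightarrow> bool" where
  "open_hardy U = (\<forall>x\<in>U. \<forall>\<^sub>F (x', y) in uniformity. x' = x \<longrightarrow> y \<in> U)"

lemma hardy_coeff_zero [simp]: "hardy_coeff 0 n = 0"
proof transfer
  fix n
  have "fps_expansion (\<lambda>z. 0) 0 = 0"
    by (intro fps_expansion_eqI has_fps_expansion_0)
  then show "fps_nth (fps_expansion (\<lambda>z. 0) 0) n = 0" by simp
qed

lemma hardy_coeff_add [simp]: "hardy_coeff (f + g) n = hardy_coeff f n + hardy_coeff g n"
  by transfer (simp add: hardy_set_def fps_expansion_add_disc)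

lemma hardy_coeff_scaleC [simp]: "hardy_coeff (hardy_scaleC c f) n = c * hardy_coeff f n"
  by transfer (simp add: hardy_set_def fps_expansion_cmult_disc)

lemma hardy_cinner_self: "hardy_cinner f f = complex_of_real (\<Sum>n. (cmod (hardy_coeff f n))\<^sup>2)"
proof -
  have "hardy_cinner f f = (\<Sum>n. complex_of_real ((cmod (hardy_coeff f n))\<^sup>2))"
    by (simp only: hardy_cinner_def complex_norm_square)
  also have "\<dots> = complex_of_real (\<Sum>n. (cmod (hardy_coeff f n))\<^sup>2)"
    by (intro suminf_of_real[symmetric] summable_hardy_coeff)
  finally show ?thesis .
qed

instance
proof
  fix f g h :: hardy and r s :: real
  show "sgn f = f /\<^sub>R norm f" by (rule sgn_hardy_def)
  show "dist f g = norm (f - g)" by (rule dist_hardy_def)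
  show "uniformity = (INF e\<in>{0<..}. principal {(x, y :: hardy). dist x y < e})"
    by (rule uniformity_hardy_def)
  show "open U = (\<forall>x\<in>U. \<forall>\<^sub>F (x', y) in uniformity. x' = x \<longrightarrow> y \<in> U)" for U :: "hardy set"
    by (rule open_hardy_def)
  have Re_eq: "Re (hardy_cinner u v) = (\<Sum>n. Re (hardy_coeff u n * cnj (hardy_coeff v n)))" for u v
    unfolding hardy_cinner_def by (rule Re_suminf[OF summable_hardy_cinner])
  have sm: "summable (\<lambda>n. Re (hardy_coeff u n * cnj (hardy_coeff v n)))" for u v
    by (intro summable_Re summable_hardy_cinner)
  show "inner f g = inner g f"
    unfolding inner_hardy_def Re_eq by (simp add: mult.commute)
  show "inner (f + g) h = inner f h + inner g h"
    unfolding inner_hardy_def Re_eq suminf_add[OF sm sm] by (simp add: algebra_simps)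
  show "inner (r *\<^sub>R f) g = r * inner f g"
    unfolding inner_hardy_def Re_eq suminf_mult[OF sm, symmetric]
    by (simp add: scaleR_hardy_def algebra_simps)
  have self: "inner f f = (\<Sum>n. (cmod (hardy_coeff f n))\<^sup>2)"
    by (simp add: inner_hardy_def hardy_cinner_self)
  show "0 \<le> inner f f"
    unfolding self by (intro suminf_nonneg summable_hardy_coeff) simp
  show "inner f f = 0 \<longleftrightarrow> f = 0"
    unfolding self using suminf_eq_zero_iff[OF summable_hardy_coeff[of f]]
    by (auto intro: hardy_eqI)
  show "norm f = sqrt (inner f f)" by (rule norm_hardy_def)
qed

end

lemma norm_hardy_eq: "norm f = sqrt (\<Sum>n. (cmod (hardy_coeff f n))\<^sup>2)"
  by (simp add: norm_hardy_def inner_hardy_def hardy_cinner_self)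

lemma hardy_cinner_self_norm: "hardy_cinner f f = complex_of_real ((norm f)\<^sup>2)"
  by (simp add: norm_hardy_eq hardy_cinner_self suminf_nonneg summable_hardy_coeff)

lemma norm_hardy_scaleC: "norm (hardy_scaleC c f) = cmod c * norm f"
  by (simp add: norm_hardy_eq norm_mult power_mult_distrib suminf_mult summable_hardy_coeff
      real_sqrt_mult)

lemma vector_space_hardy: "vector_space hardy_scaleC"
  by unfold_locales (transfer; simp add: algebra_simps)+

lemma hardy_scaleC_zero [simp]: "hardy_scaleC c 0 = 0"
  by transfer simp

lemma hardy_scaleC_minus: "hardy_scaleC c (- f) = - hardy_scaleC c f"
  by transfer simp

lemma hardy_scaleC_diff: "hardy_scaleC c (f - g) = hardy_scaleC c f - hardy_scaleC c g"
  unfolding minus_hardy_def by transfer (simp add: algebra_simps)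

lemma hardy_scaleC_of_real: "hardy_scaleC (complex_of_real r) f = r *\<^sub>R f"
  by (simp add: scaleR_hardy_def)

lemma linear_hardyI:
  assumes "\<And>f g. T (f + g) = T f + T g" "\<And>c f. T (hardy_scaleC c f) = hardy_scaleC c (T f)"
  shows "Vector_Spaces.linear hardy_scaleC hardy_scaleC T"
  using assms vector_space_hardy
  by (simp add: Vector_Spaces.linear_iff)

text \<open>
  \<^typ>\<open>hardy \<Rightarrow>\<^sub>L hardy\<close> consists of the real-linear bounded operators; its norm is the operator norm.
\<close>

typedef hardy_op = "{T :: hardy \<Rightarrow>\<^sub>L hardy. Vector_Spaces.linear hardy_scaleC hardy_scaleC (blinfun_apply T)}"
  morphisms blinfun_of_op Abs_hardy_op
proof
  show "0 \<in> {T :: hardy \<Rightarrow>\<^sub>L hardy. Vector_Spaces.linear hardy_scaleC hardy_scaleC (blinfun_apply T)}"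
    by (auto intro!: linear_hardyI)
qed

setup_lifting type_definition_hardy_op

definition op_apply :: "hardy_op \<Rightarrow> hardy \<Rightarrow> hardy" where
  "op_apply T = blinfun_apply (blinfun_of_op T)"

lemma hardy_op_eqI: "(\<And>f. op_apply T f = op_apply U f) \<Longrightarrow> T = U"
  by (metis op_apply_def blinfun_eqI blinfun_of_op_inject)

lemma bounded_linear_hardy_scaleC: "bounded_linear (hardy_scaleC c)"
proof (rule bounded_linear_intro)
  show "hardy_scaleC c (f + g) = hardy_scaleC c f + hardy_scaleC c g" for f g
    by transfer (simp add: algebra_simps)
  show "hardy_scaleC c (r *\<^sub>R f) = r *\<^sub>R hardy_scaleC c f" for r f
    unfolding scaleR_hardy_def by transfer (simp add: algebra_simps)
  show "norm (hardy_scaleC c f) \<le> norm f * cmod c" for f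
    by (simp add: norm_hardy_scaleC)
qed

lift_definition op_scaleC :: "complex \<Rightarrow> hardy_op \<Rightarrow> hardy_op"
  is "\<lambda>c T. Blinfun (hardy_scaleC c) o\<^sub>L T"
  using vector_space_hardy
  by (auto simp: Vector_Spaces.linear_iff bounded_linear_Blinfun_apply[OF bounded_linear_hardy_scaleC]
      linear_add[OF bounded_linear.linear[OF bounded_linear_hardy_scaleC]] vector_space_def mult.commute)

lift_definition op_compose :: "hardy_op \<Rightarrow> hardy_op \<Rightarrow> hardy_op" is "(o\<^sub>L)"
  by (auto simp: Vector_Spaces.linear_iff)

instantiation hardy_op :: real_vector
begin

lift_definition zero_hardy_op :: hardy_op is 0
  by (intro linear_hardyI) simp_all

lift_definition plus_hardy_op :: "hardy_op \<Rightarrow> hardy_op \<Rightarrow> hardy_op" is "(+)"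
  by (auto simp: Vector_Spaces.linear_iff blinfun.add_left vector_space_def algebra_simps)

lift_definition uminus_hardy_op :: "hardy_op \<Rightarrow> hardy_op" is uminus
  by (auto simp: Vector_Spaces.linear_iff blinfun.minus_left hardy_scaleC_minus)

lift_definition minus_hardy_op :: "hardy_op \<Rightarrow> hardy_op \<Rightarrow> hardy_op" is "(-)"
  by (auto simp: Vector_Spaces.linear_iff blinfun.diff_left hardy_scaleC_diff)

lift_definition scaleR_hardy_op :: "real \<Rightarrow> hardy_op \<Rightarrow> hardy_op" is "(*\<^sub>R)"
  by (auto simp: Vector_Spaces.linear_iff blinfun.scaleR_left scaleR_right_distrib
      hardy_scaleC_of_real[symmetric] vector_space_def mult.commute)

instance
proof
  fix T U V :: hardy_op and r s :: real
  show "T + U + V = T + (U + V)" "T + U = U + T" "0 + T = T" "- T + T = 0" "T - U = T + - U"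
    "r *\<^sub>R (T + U) = r *\<^sub>R T + r *\<^sub>R U" "(r + s) *\<^sub>R T = r *\<^sub>R T + s *\<^sub>R T"
    "r *\<^sub>R s *\<^sub>R T = (r * s) *\<^sub>R T" "1 *\<^sub>R T = T"
    by (transfer; simp add: algebra_simps)+
qed

end

instantiation hardy_op :: real_normed_vector
begin

lift_definition norm_hardy_op :: "hardy_op \<Rightarrow> real" is norm .

definition sgn_hardy_op :: "hardy_op \<Rightarrow> hardy_op" where
  "sgn_hardy_op T = T /\<^sub>R norm T"

definition dist_hardy_op :: "hardy_op \<Rightarrow> hardy_op \<Rightarrow> real" where
  "dist_hardy_op T U = norm (T - U)"

definition uniformity_hardy_op :: "(hardy_op \<times> hardy_op) filter" where
  "uniformity_hardy_op = (INF e\<in>{0<..}. principal {(x, y). dist x y < e})"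

definition open_hardy_op :: "hardy_op set \<Rightarrow> bool" where
  "open_hardy_op U = (\<forall>x\<in>U. \<forall>\<^sub>F (x', y) in uniformity. x' = x \<longrightarrow> y \<in> U)"

instance
proof
  fix T U :: hardy_op and r :: real
  show "sgn T = T /\<^sub>R norm T" by (simp add: sgn_hardy_op_def)
  show "dist T U = norm (T - U)" by (rule dist_hardy_op_def)
  show "uniformity = (INF e\<in>{0<..}. principal {(x, y :: hardy_op). dist x y < e})"
    by (rule uniformity_hardy_op_def)
  show "open W = (\<forall>x\<in>W. \<forall>\<^sub>F (x', y) in uniformity. x' = x \<longrightarrow> y \<in> W)" for W :: "hardy_op set"
    by (rule open_hardy_op_def)
  show "norm T = 0 \<longleftrightarrow> T = 0" by transfer simp
  show "norm (T + U) \<le> norm T + norm U" by transfer (rule norm_triangle_ineq)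
  show "norm (r *\<^sub>R T) = \<bar>r\<bar> * norm T" by transfer simp
qed

end

lemma op_apply_scaleC: "op_apply (op_scaleC c T) f = hardy_scaleC c (op_apply T f)"
  by (simp add: op_apply_def op_scaleC.rep_eq bounded_linear_Blinfun_apply bounded_linear_hardy_scaleC)

lemma norm_hardy_op_eq: "norm T = onorm (op_apply T)"
  by (simp add: op_apply_def norm_hardy_op.rep_eq norm_blinfun.rep_eq)

lift_definition hardy_shift :: "hardy \<Rightarrow> hardy" is "\<lambda>f z. z * f z"
  by (rule hardy_set_shift)

lemma hardy_coeff_shift: "hardy_coeff (hardy_shift f) n = (if n = 0 then 0 else hardy_coeff f (n - 1))"
  by transfer (simp add: hardy_set_def fps_expansion_shift_disc)

lemma norm_hardy_shift: "norm (hardy_shift f) = norm f"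
proof -
  have "(\<Sum>n. (cmod (hardy_coeff (hardy_shift f) n))\<^sup>2) = (\<Sum>n. (cmod (hardy_coeff f n))\<^sup>2)"
    using suminf_split_head[OF summable_hardy_coeff[of "hardy_shift f"]]
    by (simp add: hardy_coeff_shift)
  then show ?thesis
    by (simp add: norm_hardy_eq)
qed

lemma bounded_linear_hardy_shift: "bounded_linear hardy_shift"
proof (rule bounded_linear_intro)
  show "hardy_shift (f + g) = hardy_shift f + hardy_shift g" for f g
    by transfer (simp add: algebra_simps)
  show "hardy_shift (r *\<^sub>R f) = r *\<^sub>R hardy_shift f" for r f
    unfolding scaleR_hardy_def by transfer (simp add: algebra_simps)
  show "norm (hardy_shift f) \<le> norm f * 1" for f
    by (simp add: norm_hardy_shift)
qed

lift_definition shift_op :: hardy_op is "Blinfun hardy_shift"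
  unfolding bounded_linear_Blinfun_apply[OF bounded_linear_hardy_shift]
  by (rule linear_hardyI; transfer; simp add: algebra_simps)

lemma op_apply_shift: "op_apply shift_op f = hardy_shift f"
  by (simp add: op_apply_def shift_op.rep_eq bounded_linear_Blinfun_apply bounded_linear_hardy_shift)

definition left_mult :: "hardy_op \<Rightarrow> hardy_op \<Rightarrow> hardy_op" where
  "left_mult A T = op_compose A T"

end

theory Submission
  imports Defs
begin

text \<open>
  Complex linearity of left multiplication is checked pointwise on \<open>H\<^sup>2\<close>. For the norm, the shift
  only moves every Taylor coefficient up by one place, so it preserves the norm of \<open>H\<^sup>2\<close>. Hence
  \<open>\<parallel>S (T f)\<parallel> = \<parallel>T f\<parallel>\<close> for every \<open>f\<close>. The operator norm of an operator is a supremum of quotients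
  that see the operator only through the norms of its values, so \<open>\<parallel>S T\<parallel> = \<parallel>T\<parallel>\<close>.
\<close>

lemma op_apply_left_mult: "op_apply (left_mult A T) f = op_apply A (op_apply T f)"
  by (simp add: left_mult_def op_apply_def op_compose.rep_eq)

lemma op_apply_plus: "op_apply (T + U) f = op_apply T f + op_apply U f"
  by (simp add: op_apply_def plus_hardy_op.rep_eq blinfun.add_left)

lemma op_apply_linear: "Vector_Spaces.linear hardy_scaleC hardy_scaleC (op_apply T)"
  using blinfun_of_op[of T] by (simp add: op_apply_def)

lemma vector_space_hardy_op: "vector_space op_scaleC"
  by (intro vector_space.intro hardy_op_eqI)
    (simp_all add: op_apply_scaleC op_apply_plus vector_space.vector_space_assms[OF vector_space_hardy])

lemma linear_left_mult: "Vector_Spaces.linear op_scaleC op_scaleC (left_mult A)"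
proof -
  have "left_mult A (T + U) = left_mult A T + left_mult A U" for T U
    using op_apply_linear[of A]
    by (intro hardy_op_eqI) (simp add: op_apply_left_mult op_apply_plus Vector_Spaces.linear_iff)
  moreover have "left_mult A (op_scaleC c T) = op_scaleC c (left_mult A T)" for c T
    using op_apply_linear[of A]
    by (intro hardy_op_eqI) (simp add: op_apply_left_mult op_apply_scaleC Vector_Spaces.linear_iff)
  ultimately show ?thesis
    by (simp add: Vector_Spaces.linear_iff vector_space_hardy_op)
qed

lemma norm_left_mult_isometry:
  assumes "\<And>f. norm (op_apply A f) = norm f"
  shows "norm (left_mult A T) = norm T"
  by (simp add: norm_hardy_op_eq onorm_def op_apply_left_mult assms)

theorem corollary2p3:
  shows "Vector_Spaces.linear op_scaleC op_scaleC (left_mult shift_op) \<and>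
         (\<forall>T. norm (left_mult shift_op T) = norm T)"
  by (simp add: linear_left_mult norm_left_mult_isometry op_apply_shift norm_hardy_shift)

end
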